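(* Assume one of the following two settings. (a) $\mathcal{A}$ is a unital associative complex algebra, $\mathcal{M}$ is a unital $\mathcal{A}$-bimodule satisfying property $\mathbb{M}$, and $D:\mathcal{A}\to\mathcal{M}$ is a linear map. (b) $\mathcal{A}$ is a unital complex Banach algebra, $\mathcal{M}$ is a unital Banach $\mathcal{A}$-bimodule satisfying property $\mathbb{M}'$, and $D:\mathcal{A}\to\mathcal{M}$ is a continuous linear map. Suppose that for all $a,b\in\mathcal{A}$, $$ab=ba=0\ \Rightarrow\ aD(b)+D(a)b=0.$$ Then $D$ is a generalized Jordan derivation and $aD(1)=D(1)a$ for all $a\in\mathcal{A}$.
   Context: All algebras are associative and unital over $\mathbb{C}$, and all modules are unital. $a\circ b=ab+ba$ for $a,b\in\mathcal{A}$, and $a\bullet m=m\bullet a=am+ma$ for $a\in\mathcal{A}$, $m\in\mathcal{M}$. $\mathfrak{I}(\mathcal{A})$ denotes the set of all (finite) linear combinations of idempotents of $\mathcal{A}$; $\overline{\mathfrak{I}(\mathcal{A})}$ is its norm closure when $\mathcal{A}$ is a Banach algebra. An $\mathcal{A}$-bimodule $\mathcal{M}$ satisfies property $\mathbb{M}$ if there is a (two-sided) ideal $\mathcal{J}$ of $\mathcal{A}$ with $\mathcal{J}\subseteq\mathfrak{I}(\mathcal{A})$ and $\{m\in\mathcal{M}\mid xmx=0 \text{ for all } x\in\mathcal{J}\}=\{0\}$. If $\mathcal{A}$ is a Banach algebra and $\mathcal{M}$ is a Banach $\mathcal{A}$-bimodule, $\mathcal{M}$ satisfies property $\mathbb{M}'$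 if there is a (two-sided) ideal $\mathcal{J}$ of $\mathcal{A}$ with $\mathcal{J}\subseteq\overline{\mathfrak{I}(\mathcal{A})}$ and $\{m\in\mathcal{M}\mid xmx=0 \text{ for all } x\in\mathcal{J}\}=\{0\}$. A linear map $D:\mathcal{A}\to\mathcal{M}$ is a generalized Jordan derivation if $D(a\circ b)=D(a)\bullet b+a\bullet D(b)-aD(1)b-bD(1)a$ for all $a,b\in\mathcal{A}$. *)

theory Defs
  imports "HOL-Analysis.Analysis"
begin

text \<open>
  The sort \<open>{ring, monoid_mult}\<close> is a unital ring that is allowed to be zero
  (\<open>ring_1\<close> would require \<open>0 \<noteq> 1\<close>).
\<close>

locale complex_algebra = vector_space scale
  for scale :: "complex \<Rightarrow> 'a::{ring, monoid_mult} \<Rightarrow> 'a" +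
  assumes scale_mult_left: "scale c x * y = scale c (x * y)"
    and scale_mult_right: "x * scale c y = scale c (x * y)"

locale unital_bimodule = A: complex_algebra scaleA + M: vector_space scaleM
  for scaleA :: "complex \<Rightarrow> 'a::{ring, monoid_mult} \<Rightarrow> 'a"
    and scaleM :: "complex \<Rightarrow> 'm::ab_group_add \<Rightarrow> 'm" +
  fixes lact :: "'a \<Rightarrow> 'm \<Rightarrow> 'm"
    and ract :: "'m \<Rightarrow> 'a \<Rightarrow> 'm"
  assumes lact_linear_alg: "Vector_Spaces.linear scaleA scaleM (\<lambda>a. lact a m)"
    and lact_linear_mod: "Vector_Spaces.linear scaleM scaleM (\<lambda>m. lact a m)"
    and ract_linear_alg: "Vector_Spaces.linear scaleA scaleM (\<lambda>a. ract m a)"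
    and ract_linear_mod: "Vector_Spaces.linear scaleM scaleM (\<lambda>m. ract m a)"
    and lact_mult: "lact (a * b) m = lact a (lact b m)"
    and ract_mult: "ract m (a * b) = ract (ract m a) b"
    and lact_ract: "ract (lact a m) b = lact a (ract m b)"
    and lact_one: "lact 1 m = m"
    and ract_one: "ract m 1 = m"

text \<open>
  The normed classes of the library are real.  A complex normed space is such a space with a
  complex scalar multiplication that extends the real one and is compatible with the norm.
\<close>

locale complex_normed_space = vector_space scale
  for scale :: "complex \<Rightarrow> 'v::real_normed_vector \<Rightarrow> 'v" +
  assumes scale_of_real: "scale (of_real r) x = r *\<^sub>R x"
    and norm_scale: "norm (scale c x) = cmod c * norm x"

text \<open>
  \<open>real_normed_algebra\<close> makes the norm submultiplicative; \<open>norm 1 = 1\<close> is not required.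
\<close>

locale complex_banach_algebra = complex_algebra scale + complex_normed_space scale
  for scale :: "complex \<Rightarrow> 'a::{real_normed_algebra, monoid_mult, banach} \<Rightarrow> 'a"

text \<open>
  The module actions are only required to be bounded by some constant:
  \<open>norm (lact a m) \<le> norm a * norm m * K\<close>, and likewise on the right.
\<close>

locale unital_banach_bimodule =
  unital_bimodule scaleA scaleM lact ract +
  A: complex_banach_algebra scaleA + M: complex_normed_space scaleM
  for scaleA :: "complex \<Rightarrow> 'a::{real_normed_algebra, monoid_mult, banach} \<Rightarrow> 'a"
    and scaleM :: "complex \<Rightarrow> 'm::banach \<Rightarrow> 'm"
    and lact :: "'a \<Rightarrow> 'm \<Rightarrow> 'm"
    and ract :: "'m \<Rightarrow> 'a \<Rightarrow> 'm" +
  assumes lact_bounded: "bounded_bilinear lact"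
    and ract_bounded: "bounded_bilinear ract"

definition idempotent_span ::
    "(complex \<Rightarrow> 'a::{ring, monoid_mult} \<Rightarrow> 'a) \<Rightarrow> 'a set" where
  "idempotent_span scaleA = module.span scaleA {e. e * e = e}"

definition two_sided_ideal ::
    "(complex \<Rightarrow> 'a::{ring, monoid_mult} \<Rightarrow> 'a) \<Rightarrow> 'a set \<Rightarrow> bool" where
  "two_sided_ideal scaleA J \<longleftrightarrow>
     module.subspace scaleA J \<and> (\<forall>a. \<forall>x\<in>J. a * x \<in> J \<and> x * a \<in> J)"

definition property_M ::
    "(complex \<Rightarrow> 'a::{ring, monoid_mult} \<Rightarrow> 'a) \<Rightarrow>
     ('a \<Rightarrow> 'm::ab_group_add \<Rightarrow> 'm) \<Rightarrow> ('m \<Rightarrow> 'a \<Rightarrow> 'm) \<Rightarrow> bool" where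
  "property_M scaleA lact ract \<longleftrightarrow>
     (\<exists>J. two_sided_ideal scaleA J \<and> J \<subseteq> idempotent_span scaleA \<and>
          {m. \<forall>x\<in>J. ract (lact x m) x = 0} = {0})"

definition property_M' ::
    "(complex \<Rightarrow> 'a::{real_normed_algebra, monoid_mult, banach} \<Rightarrow> 'a) \<Rightarrow>
     ('a \<Rightarrow> 'm::banach \<Rightarrow> 'm) \<Rightarrow> ('m \<Rightarrow> 'a \<Rightarrow> 'm) \<Rightarrow> bool" where
  "property_M' scaleA lact ract \<longleftrightarrow>
     (\<exists>J. two_sided_ideal scaleA J \<and> J \<subseteq> closure (idempotent_span scaleA) \<and>
          {m. \<forall>x\<in>J. ract (lact x m) x = 0} = {0})"

definition jordan_product :: "'a::{ring, monoid_mult} \<Rightarrow> 'a \<Rightarrow> 'a" where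
  "jordan_product a b = a * b + b * a"

text \<open>This is both \<open>a \<bullet> m\<close> and \<open>m \<bullet> a\<close>, which coincide.\<close>

definition jordan_action ::
    "('a::{ring, monoid_mult} \<Rightarrow> 'm::ab_group_add \<Rightarrow> 'm) \<Rightarrow> ('m \<Rightarrow> 'a \<Rightarrow> 'm) \<Rightarrow>
     'a \<Rightarrow> 'm \<Rightarrow> 'm" where
  "jordan_action lact ract a m = lact a m + ract m a"

definition generalized_jordan_derivation ::
    "(complex \<Rightarrow> 'a::{ring, monoid_mult} \<Rightarrow> 'a) \<Rightarrow> (complex \<Rightarrow> 'm::ab_group_add \<Rightarrow> 'm) \<Rightarrow>
     ('a \<Rightarrow> 'm \<Rightarrow> 'm) \<Rightarrow> ('m \<Rightarrow> 'a \<Rightarrow> 'm) \<Rightarrow> ('a \<Rightarrow> 'm) \<Rightarrow> bool" where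
  "generalized_jordan_derivation scaleA scaleM lact ract D \<longleftrightarrow>
     Vector_Spaces.linear scaleA scaleM D \<and>
     (\<forall>a b. D (jordan_product a b) =
        jordan_action lact ract b (D a) + jordan_action lact ract a (D b)
        - ract (lact a (D 1)) b - ract (lact b (D 1)) a)"

end

theory Submission
  imports Defs
begin

text \<open>
  Put \<open>\<phi> a b = a D(b) + D(a) b\<close>, a bilinear map that vanishes whenever \<open>ab = ba = 0\<close>.

  An idempotent \<open>e\<close> supplies many such pairs: \<open>e a e\<close> against \<open>1 - e\<close>, and, since
  \<open>e + e a (1 - e)\<close> is again idempotent, also \<open>e + e a (1 - e)\<close> against its complement.  Adding up
  the resulting equations over the Peirce components of \<open>a\<close> gives
  \<open>\<phi>(a, e) + \<phi>(e, a) = \<phi>(a e, 1) + \<phi>(1, e a)\<close> and \<open>\<phi>(e, 1) = \<phi>(1, e)\<close>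
  (\<open>idempotent_jordan_balanced\<close>).  Both equations are linear in \<open>e\<close>, so they hold for every
  linear combination \<open>x\<close> of idempotents, and for limits of these when \<open>\<phi>\<close> is continuous; in
  particular they hold for \<open>x\<close> in the given ideal \<open>J\<close>.

  The second equation says that \<open>D(1)\<close> commutes with \<open>J\<close>.  As \<open>J\<close> is an ideal,
  \<open>x (a D(1) - D(1) a) = 0\<close> for every \<open>x\<close> in \<open>J\<close>, and faithfulness of
  \<open>m \<mapsto> (x m x)\<^sub>x\<close> makes \<open>D(1)\<close> central (\<open>central_if_commutes_on_faithful_ideal\<close>).
  The first equation then says that \<open>d(a) = D(a) - a D(1)\<close> satisfies
  \<open>d(a \<circ> x) = d(a) \<bullet> x + a \<bullet> d(x)\<close> as soon as one of the two arguments lies in \<open>J\<close>.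
  The remaining step is purely Jordan-theoretic (\<open>jordan_derivation_if_on_faithful_ideal\<close>):
  such a \<open>d\<close> satisfies \<open>d(x a x) = d(x) a x + x d(a) x + x a d(x)\<close> for \<open>x\<close> in \<open>J\<close> and
  arbitrary \<open>a\<close>.  Computing \<open>d(x (a \<circ> b) x)\<close> once with this rule and once
  through its polarisation shows that the defect of the Jordan rule at \<open>(a, b)\<close> is
  killed by \<open>m \<mapsto> x m x\<close> for all \<open>x\<close> in \<open>J\<close>, so it is zero.
\<close>

section \<open>Bilinear maps vanishing on two-sided zero products\<close>

text \<open>
  The common form of what is extracted from the idempotents: a condition on \<open>x\<close> that is linear
  in \<open>x\<close> and closed if \<open>\<phi>\<close> is continuous.
\<close>

definition jordan_balanced ::
    "('a::{ring, monoid_mult} \<Rightarrow> 'a \<Rightarrow> 'm::ab_group_add) \<Rightarrow> 'a \<Rightarrow> bool" where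
  "jordan_balanced \<phi> x \<longleftrightarrow>
     (\<forall>a. \<phi> a x + \<phi> x a = \<phi> (a * x) 1 + \<phi> 1 (x * a)) \<and> \<phi> x 1 = \<phi> 1 x"

text \<open>
  The element \<open>e + n\<close> is idempotent again, so \<open>\<phi>\<close> vanishes on it and its complement
  \<open>1 - e - n\<close>.  Expanding leaves the two mixed terms, because the pairs \<open>(e, 1 - e)\<close> and
  \<open>(n, n)\<close> have zero products as well.
\<close>

lemma idempotent_shift_balanced:
  fixes \<phi> :: "'a::{ring, monoid_mult} \<Rightarrow> 'a \<Rightarrow> 'm::ab_group_add"
  assumes left: "\<And>b. Modules.additive (\<lambda>a. \<phi> a b)"
    and right: "\<And>a. Modules.additive (\<phi> a)"
    and zero: "\<And>a b. a * b = 0 \<Longrightarrow> b * a = 0 \<Longrightarrow> \<phi> a b = 0"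
    and e: "e * e = e" and n: "e * n + n * e = n" "n * n = 0"
  shows "\<phi> n (1 - e) = \<phi> e n"
proof -
  note additivity =
    additive.add[OF left] additive.diff[OF left] additive.add[OF right] additive.diff[OF right]
  have "\<phi> (e + n) (1 - e - n) = 0"
  proof (rule zero)
    have "(e + n) * (1 - e - n) = e - e * e + n - (e * n + n * e) - n * n"
      by (simp add: algebra_simps)
    then show "(e + n) * (1 - e - n) = 0" using e n by simp
    have "(1 - e - n) * (e + n) = e - e * e + n - (e * n + n * e) - n * n"
      by (simp add: algebra_simps)
    then show "(1 - e - n) * (e + n) = 0" using e n by simp
  qed
  moreover have "\<phi> e (1 - e) = 0"
    by (rule zero) (simp_all add: algebra_simps e)
  moreover have "\<phi> n n = 0"
    by (rule zero) (simp_all add: n)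
  ultimately show ?thesis
    by (simp add: additivity)
qed

text \<open>
  In the Peirce decomposition of \<open>a\<close> the diagonal components have zero products with \<open>e\<close> or
  with \<open>1 - e\<close>, and the off-diagonal ones can be moved by the shift above.
\<close>

lemma idempotent_jordan_balanced:
  fixes \<phi> :: "'a::{ring, monoid_mult} \<Rightarrow> 'a \<Rightarrow> 'm::ab_group_add"
  assumes left: "\<And>b. Modules.additive (\<lambda>a. \<phi> a b)"
    and right: "\<And>a. Modules.additive (\<phi> a)"
    and zero: "\<And>a b. a * b = 0 \<Longrightarrow> b * a = 0 \<Longrightarrow> \<phi> a b = 0"
    and e: "e * e = e"
  shows "jordan_balanced \<phi> e"
  unfolding jordan_balanced_def
proof (intro conjI allI)
  note additivity =
    additive.add[OF left] additive.diff[OF left] additive.add[OF right] additive.diff[OF right]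
  have ee: "e * (e * z) = e * z" for z
    using e by (metis mult.assoc)
  show "\<phi> e 1 = \<phi> 1 e"
  proof -
    have "\<phi> e (1 - e) = 0" "\<phi> (1 - e) e = 0"
      by (rule zero; simp add: algebra_simps e)+
    then show ?thesis by (simp add: additivity)
  qed
  fix a
  define f where "f = 1 - e"
  define p q r s where "p = e * a * e" and "q = e * a * f" and "r = f * a * e" and "s = f * a * f"
  note peirce = p_def q_def r_def s_def f_def
  have a: "a = p + q + r + s" and ae: "a * e = p + r" and ea: "e * a = p + q"
    by (simp_all add: peirce algebra_simps)
  have p: "\<phi> p (1 - e) = 0" "\<phi> (1 - e) p = 0"
    by (rule zero; simp add: peirce algebra_simps e ee)+
  have s: "\<phi> s e = 0" "\<phi> e s = 0"
    by (rule zero; simp add: peirce algebra_simps e ee)+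
  have q: "\<phi> q (1 - e) = \<phi> e q"
    by (rule idempotent_shift_balanced[OF left right zero e])
      (simp_all add: peirce algebra_simps e ee)
  have r: "\<phi> r (1 - e) = \<phi> e r"
    by (rule idempotent_shift_balanced[OF left right zero e])
      (simp_all add: peirce algebra_simps e ee)
  \<comment> \<open>The shift for the complementary idempotent, whose complement is \<open>e\<close>.\<close>
  have q': "\<phi> q e = \<phi> (1 - e) q"
    using idempotent_shift_balanced[OF left right zero, of "1 - e" q]
    by (simp add: peirce algebra_simps e ee)
  show "\<phi> a e + \<phi> e a = \<phi> (a * e) 1 + \<phi> 1 (e * a)"
    unfolding ae ea unfolding a using p q r s q'
    by (simp add: additivity algebra_simps)
qed

lemma (in unital_bimodule) idempotent_span_jordan_balanced:
  assumes left: "\<And>b. Vector_Spaces.linear scaleA scaleM (\<lambda>a. \<phi> a b)"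
    and right: "\<And>a. Vector_Spaces.linear scaleA scaleM (\<phi> a)"
    and zero: "\<And>a b. a * b = 0 \<Longrightarrow> b * a = 0 \<Longrightarrow> \<phi> a b = 0"
    and x: "x \<in> idempotent_span scaleA"
  shows "jordan_balanced \<phi> x"
proof -
  have left_additive: "Modules.additive (\<lambda>a. \<phi> a b)" for b
    by (rule Modules.additive.intro) (rule module_hom.add[OF Vector_Spaces.linear.axioms(3)[OF left]])
  have right_additive: "Modules.additive (\<phi> a)" for a
    by (rule Modules.additive.intro) (rule module_hom.add[OF Vector_Spaces.linear.axioms(3)[OF right]])
  note linearity =
    additive.add[OF left_additive] additive.add[OF right_additive]
    additive.zero[OF left_additive] additive.zero[OF right_additive]
    module_hom.scale[OF Vector_Spaces.linear.axioms(3)[OF left]] module_hom.scale[OF Vector_Spaces.linear.axioms(3)[OF right]]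
  have "A.subspace {x. jordan_balanced \<phi> x}"
  proof (rule A.subspaceI)
    show "0 \<in> {x. jordan_balanced \<phi> x}"
      by (simp add: jordan_balanced_def linearity)
  next
    fix x y
    assume "x \<in> {x. jordan_balanced \<phi> x}" "y \<in> {x. jordan_balanced \<phi> x}"
    then have x: "\<phi> a x + \<phi> x a = \<phi> (a * x) 1 + \<phi> 1 (x * a)" "\<phi> x 1 = \<phi> 1 x"
      and y: "\<phi> a y + \<phi> y a = \<phi> (a * y) 1 + \<phi> 1 (y * a)" "\<phi> y 1 = \<phi> 1 y" for a
      by (simp_all add: jordan_balanced_def)
    have "\<phi> a (x + y) + \<phi> (x + y) a = \<phi> (a * (x + y)) 1 + \<phi> 1 ((x + y) * a)" for a
    proof -
      have "\<phi> a (x + y) + \<phi> (x + y) a = (\<phi> a x + \<phi> x a) + (\<phi> a y + \<phi> y a)"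
        by (simp add: linearity)
      then show ?thesis unfolding x y by (simp add: linearity algebra_simps)
    qed
    then show "x + y \<in> {x. jordan_balanced \<phi> x}"
      using x y by (simp add: jordan_balanced_def linearity)
  next
    fix c x
    assume "x \<in> {x. jordan_balanced \<phi> x}"
    then show "scaleA c x \<in> {x. jordan_balanced \<phi> x}"
      by (simp add: jordan_balanced_def linearity A.scale_mult_left A.scale_mult_right
          M.scale_right_distrib[symmetric])
  qed
  moreover have "{e. e * e = e} \<subseteq> {x. jordan_balanced \<phi> x}"
    using idempotent_jordan_balanced[OF left_additive right_additive zero] by blast
  ultimately show ?thesis
    using x A.span_minimal unfolding idempotent_span_def by blast
qed

section \<open>Extension from a faithful ideal\<close>

context unital_bimodule
begin

lemmas action_additive =
  module_hom.add[OF Vector_Spaces.linear.axioms(3)[OF lact_linear_alg]]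
  module_hom.add[OF Vector_Spaces.linear.axioms(3)[OF lact_linear_mod]]
  module_hom.add[OF Vector_Spaces.linear.axioms(3)[OF ract_linear_alg]]
  module_hom.add[OF Vector_Spaces.linear.axioms(3)[OF ract_linear_mod]]
  module_hom.diff[OF Vector_Spaces.linear.axioms(3)[OF lact_linear_alg]]
  module_hom.diff[OF Vector_Spaces.linear.axioms(3)[OF lact_linear_mod]]
  module_hom.diff[OF Vector_Spaces.linear.axioms(3)[OF ract_linear_alg]]
  module_hom.diff[OF Vector_Spaces.linear.axioms(3)[OF ract_linear_mod]]

text \<open>
  These rules bring a term of the bimodule into a sum of monomials
  \<open>a\<^sub>1 (a\<^sub>2 \<dots> ((m b\<^sub>1) b\<^sub>2) \<dots>)\<close>, so that the multilinear identities below
  reduce to commutativity of addition.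
\<close>

lemmas action_simps = action_additive lact_mult ract_mult lact_ract

lemma eq_if_double_eq:
  assumes "m + m = n + (n :: 'm)" shows "m = n"
proof -
  have "scaleM 2 m = scaleM 2 n"
    using assms M.scale_left_distrib[of 1 1] by simp
  then show ?thesis by simp
qed

lemma zero_right: "ract 0 x = 0" and zero_left: "lact x 0 = 0"
  using action_additive(8)[of 0 0 x] action_additive(6)[of x 0 0] by simp_all

text \<open>
  For \<open>x\<close> in \<open>J\<close> also \<open>x a\<close> is in \<open>J\<close>, so \<open>x a z = z x a = x z a\<close>.
\<close>

lemma central_if_commutes_on_faithful_ideal:
  assumes J: "two_sided_ideal scaleA J"
    and faithful: "{m. \<forall>x\<in>J. ract (lact x m) x = 0} = {0}"
    and commutes: "\<And>x. x \<in> J \<Longrightarrow> lact x z = ract z x"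
  shows "lact a z = ract z a"
proof -
  have "lact x (lact a z - ract z a) = 0" if "x \<in> J" for x
  proof -
    have "x * a \<in> J" using J that by (simp add: two_sided_ideal_def)
    then have "lact x (lact a z) = ract (ract z x) a"
      using commutes by (metis lact_mult ract_mult)
    also have "\<dots> = lact x (ract z a)"
      using commutes[OF that] by (metis lact_ract)
    finally show ?thesis by (simp add: action_additive)
  qed
  then have "lact a z - ract z a \<in> {m. \<forall>x\<in>J. ract (lact x m) x = 0}"
    by (simp add: zero_right)
  then show ?thesis unfolding faithful by simp
qed

text \<open>
  The usual expression \<open>2 x a x = x \<circ> (x \<circ> a) - x\<^sup>2 \<circ> a\<close>; every Jordan product in it has a
  factor in the ideal, although \<open>a\<close> is arbitrary.
\<close>

lemma jordan_triple_rule: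
  assumes d: "Modules.additive d"
    and J: "two_sided_ideal scaleA J"
    and jordan_on_J: "\<forall>a. \<forall>x\<in>J.
      d (a * x + x * a) = ract (d a) x + lact x (d a) + lact a (d x) + ract (d x) a"
    and x: "x \<in> J"
  shows "d (x * a * x) = ract (ract (d x) a) x + lact x (ract (d a) x) + lact x (lact a (d x))"
    (is "_ = ?R")
proof (rule eq_if_double_eq)
  note jordan = jordan_on_J[rule_format]
  have mem: "a * x + x * a \<in> J" "x * x \<in> J"
    using J x A.subspace_add unfolding two_sided_ideal_def by blast+
  have "d (x * a * x) + d (x * a * x) =
      d (x * (a * x + x * a) + (a * x + x * a) * x - (a * (x * x) + (x * x) * a))"
    by (simp add: additive.add[OF d, symmetric] algebra_simps)
  also have "\<dots> = d (x * (a * x + x * a) + (a * x + x * a) * x) - d (a * (x * x) + (x * x) * a)"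
    by (rule additive.diff[OF d])
  also have "\<dots> = ?R + ?R"
  proof -
    \<comment> \<open>The rule at \<open>(x, x)\<close> is twice this equation.\<close>
    have square: "d (x * x) = ract (d x) x + lact x (d x)"
      by (rule eq_if_double_eq)
        (use jordan[OF x, of x] in \<open>simp add: additive.add[OF d] algebra_simps\<close>)
    show ?thesis
      unfolding jordan[OF mem(1)] jordan[OF mem(2)] jordan[OF x] square
      by (simp add: action_simps algebra_simps)
  qed
  finally show "d (x * a * x) + d (x * a * x) = ?R + ?R" .
qed

lemma jordan_triple_rule_polarised:
  assumes d: "Modules.additive d"
    and J: "two_sided_ideal scaleA J"
    and jordan_on_J: "\<forall>a. \<forall>x\<in>J.
      d (a * x + x * a) = ract (d a) x + lact x (d a) + lact a (d x) + ract (d x) a"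
    and x: "x \<in> J" and y: "y \<in> J"
  shows "d (x * a * y + y * a * x) =
      ract (ract (d x) a) y + lact x (ract (d a) y) + lact x (lact a (d y)) +
      (ract (ract (d y) a) x + lact y (ract (d a) x) + lact y (lact a (d x)))"
proof -
  note triple = jordan_triple_rule[OF d J jordan_on_J]
  have "x + y \<in> J"
    using J x y A.subspace_add unfolding two_sided_ideal_def by blast
  have "d (x * a * y + y * a * x) = d ((x + y) * a * (x + y) - x * a * x - y * a * y)"
    by (simp add: algebra_simps)
  also have "\<dots> = d ((x + y) * a * (x + y)) - d (x * a * x) - d (y * a * y)"
    by (simp only: additive.diff[OF d])
  finally show ?thesis
    unfolding triple[OF \<open>x + y \<in> J\<close>] triple[OF x] triple[OF y]
    by (simp add: action_simps additive.add[OF d] algebra_simps)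
qed

text \<open>
  The two ways of computing \<open>d (x (a \<circ> b) x)\<close> come from
  \<open>x (a \<circ> b) x = {xa, b, x} + {ax, b, x} - (x b x) \<circ> a\<close>, with
  \<open>{u, b, v} = u b v + v b u\<close>: on the right all factors that the rules need in the ideal are in
  it, and on the left only the inner factor \<open>a \<circ> b\<close> is unknown.
\<close>

lemma jordan_derivation_if_on_faithful_ideal:
  assumes d: "Modules.additive d"
    and J: "two_sided_ideal scaleA J"
    and faithful: "{m. \<forall>x\<in>J. ract (lact x m) x = 0} = {0}"
    and jordan_on_J: "\<forall>a. \<forall>x\<in>J.
      d (a * x + x * a) = ract (d a) x + lact x (d a) + lact a (d x) + ract (d x) a"
  shows "d (a * b + b * a) = ract (d a) b + lact b (d a) + lact a (d b) + ract (d b) a"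
    (is "_ = ?R")
proof -
  note triple = jordan_triple_rule[OF d J jordan_on_J]
  note jordan = jordan_on_J[rule_format]
  note polarised = jordan_triple_rule_polarised[OF d J jordan_on_J]
  have "ract (lact x (d (a * b + b * a) - ?R)) x = 0" if x: "x \<in> J" for x
  proof -
    have mem: "x * a \<in> J" "a * x \<in> J" "x * b * x \<in> J"
      using J x unfolding two_sided_ideal_def by blast+
    have "d (x * (a * b + b * a) * x) =
        d ((x * a) * b * x + x * b * (x * a) + ((a * x) * b * x + x * b * (a * x))
          - (a * (x * b * x) + (x * b * x) * a))"
      by (simp add: algebra_simps)
    also have "\<dots> = d ((x * a) * b * x + x * b * (x * a)) + d ((a * x) * b * x + x * b * (a * x))
          - d (a * (x * b * x) + (x * b * x) * a)"
      by (simp only: additive.add[OF d] additive.diff[OF d])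
    also have "\<dots> =
        ract (ract (d (a * x + x * a)) b) x + lact x (lact b (d (a * x + x * a)))
        + lact (x * a) (ract (d b) x) + lact (x * a) (lact b (d x))
        + ract (ract (d x) b) (x * a) + lact x (ract (d b) (x * a))
        + lact (a * x) (ract (d b) x) + lact (a * x) (lact b (d x))
        + ract (ract (d x) b) (a * x) + lact x (ract (d b) (a * x))
        - (ract (d a) (x * b * x) + lact (x * b * x) (d a)
          + lact a (d (x * b * x)) + ract (d (x * b * x)) a)"
      unfolding polarised[OF mem(1) x] polarised[OF mem(2) x] jordan[OF mem(3)]
      by (simp add: action_simps additive.add[OF d] algebra_simps)
    also have "\<dots> = ract (ract (d x) (a * b + b * a)) x + lact x (ract ?R x)
        + lact x (lact (a * b + b * a) (d x))"
      unfolding jordan[OF x] triple[OF x]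
      by (simp add: action_simps algebra_simps)
    finally have "lact x (ract (d (a * b + b * a)) x) = lact x (ract ?R x)"
      unfolding triple[OF x] by (simp only: add_left_cancel add_right_cancel)
    then show ?thesis by (simp add: lact_ract action_additive(6,8))
  qed
  then have "d (a * b + b * a) - ?R \<in> {m. \<forall>x\<in>J. ract (lact x m) x = 0}" by blast
  then show ?thesis unfolding faithful by simp
qed

lemma generalized_jordan_derivation_if_jordan_balanced:
  assumes D: "Vector_Spaces.linear scaleA scaleM D"
    and J: "two_sided_ideal scaleA J"
    and faithful: "{m. \<forall>x\<in>J. ract (lact x m) x = 0} = {0}"
    and balanced: "\<And>x. x \<in> J \<Longrightarrow> jordan_balanced (\<lambda>a b. lact a (D b) + ract (D a) b) x"
  shows "generalized_jordan_derivation scaleA scaleM lact ract D \<and> (\<forall>a. lact a (D 1) = ract (D 1) a)"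
proof -
  have "lact x (D 1) = ract (D 1) x" if "x \<in> J" for x
    using balanced[OF that] unfolding jordan_balanced_def by (simp add: lact_one ract_one)
  then have central: "lact a (D 1) = ract (D 1) a" for a
    by (rule central_if_commutes_on_faithful_ideal[OF J faithful])
  note D_add = module_hom.add[OF Vector_Spaces.linear.axioms(3)[OF D]]
  define d where "d a = D a - lact a (D 1)" for a
  have D_eq: "D a = d a + lact a (D 1)" for a
    by (simp add: d_def)
  have d: "Modules.additive d"
    by (rule Modules.additive.intro) (simp add: d_def D_add action_additive)
  \<comment> \<open>Moving \<open>D 1\<close> to the right of everything makes its contributions cancel.\<close>
  have shift: "ract (lact a (D 1)) b = lact a (lact b (D 1))" for a b
    by (simp add: lact_ract central[symmetric])
  have "\<forall>a. \<forall>x\<in>J. d (a * x + x * a) = ract (d a) x + lact x (d a) + lact a (d x) + ract (d x) a"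
  proof (intro allI ballI)
    fix a x
    assume "x \<in> J"
    have "lact a (D x) + ract (D a) x + (lact x (D a) + ract (D x) a) =
        lact (a * x) (D 1) + D (a * x) + (D (x * a) + ract (D 1) (x * a))"
      using balanced[OF \<open>x \<in> J\<close>] by (simp add: jordan_balanced_def lact_one ract_one)
    then have "D (a * x + x * a) = lact a (D x) + ract (D a) x + lact x (D a) + ract (D x) a
        - lact a (lact x (D 1)) - lact x (lact a (D 1))"
      by (simp add: D_add central[symmetric] lact_mult algebra_simps)
    then show "d (a * x + x * a) = ract (d a) x + lact x (d a) + lact a (d x) + ract (d x) a"
      by (simp add: d_def action_additive shift lact_mult algebra_simps)
  qed
  from jordan_derivation_if_on_faithful_ideal[OF d J faithful this]
  have "d (a * b + b * a) = ract (d a) b + lact b (d a) + lact a (d b) + ract (d b) a" for a b .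
  then have D_jordan: "D (a * b + b * a) =
      ract (d a) b + lact b (d a) + lact a (d b) + ract (d b) a + lact (a * b + b * a) (D 1)" for a b
    using D_eq by metis
  have "D (jordan_product a b) = jordan_action lact ract b (D a) + jordan_action lact ract a (D b)
        - ract (lact a (D 1)) b - ract (lact b (D 1)) a" for a b
    unfolding jordan_product_def jordan_action_def D_jordan
    by (simp add: d_def action_additive shift lact_mult algebra_simps)
  then show ?thesis
    using D central by (simp add: generalized_jordan_derivation_def)
qed

lemma derivation_pairing_linear:
  assumes D: "Vector_Spaces.linear scaleA scaleM D"
  shows "Vector_Spaces.linear scaleA scaleM (\<lambda>a. lact a (D b) + ract (D a) b)"
    and "Vector_Spaces.linear scaleA scaleM (\<lambda>b. lact a (D b) + ract (D a) b)"
proof -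
  interpret P: vector_space_pair scaleA scaleM ..
  show "Vector_Spaces.linear scaleA scaleM (\<lambda>a. lact a (D b) + ract (D a) b)"
    using P.linear_compose_add[OF lact_linear_alg Vector_Spaces.linear_compose[OF D ract_linear_mod]]
    by (simp add: o_def)
  show "Vector_Spaces.linear scaleA scaleM (\<lambda>b. lact a (D b) + ract (D a) b)"
    using P.linear_compose_add[OF Vector_Spaces.linear_compose[OF D lact_linear_mod] ract_linear_alg]
    by (simp add: o_def)
qed

end

section \<open>The algebraic and the Banach setting\<close>

lemma (in unital_bimodule) zero_product_condition_property_M:
  assumes M: "property_M scaleA lact ract"
    and D: "Vector_Spaces.linear scaleA scaleM D"
    and zero: "\<And>a b. a * b = 0 \<Longrightarrow> b * a = 0 \<Longrightarrow> lact a (D b) + ract (D a) b = 0"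
  shows "generalized_jordan_derivation scaleA scaleM lact ract D \<and> (\<forall>a. lact a (D 1) = ract (D 1) a)"
proof -
  obtain J where J: "two_sided_ideal scaleA J" "J \<subseteq> idempotent_span scaleA"
      "{m. \<forall>x\<in>J. ract (lact x m) x = 0} = {0}"
    using M unfolding property_M_def by auto
  have balanced: "jordan_balanced (\<lambda>a b. lact a (D b) + ract (D a) b) x" if "x \<in> J" for x
    by (rule idempotent_span_jordan_balanced[OF derivation_pairing_linear[OF D] zero subsetD[OF J(2) that]])
  show ?thesis
    by (rule generalized_jordan_derivation_if_jordan_balanced[OF D J(1,3) balanced])
qed

text \<open>
  Continuity of \<open>D\<close> and of the two actions makes \<open>jordan_balanced\<close> a closed condition, which
  is what carries it from the span of the idempotents to its closure.
\<close>

lemma (in unital_banach_bimodule) zero_product_condition_property_M':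
  assumes M: "property_M' scaleA lact ract"
    and D: "Vector_Spaces.linear scaleA scaleM D" and cont: "continuous_on UNIV D"
    and zero: "\<And>a b. a * b = 0 \<Longrightarrow> b * a = 0 \<Longrightarrow> lact a (D b) + ract (D a) b = 0"
  shows "generalized_jordan_derivation scaleA scaleM lact ract D \<and> (\<forall>a. lact a (D 1) = ract (D 1) a)"
proof -
  obtain J where J: "two_sided_ideal scaleA J" "J \<subseteq> closure (idempotent_span scaleA)"
      "{m. \<forall>x\<in>J. ract (lact x m) x = 0} = {0}"
    using M unfolding property_M'_def by auto
  let ?\<phi> = "\<lambda>a b. lact a (D b) + ract (D a) b"
  have "idempotent_span scaleA \<subseteq> {x. jordan_balanced ?\<phi> x}"
    using idempotent_span_jordan_balanced[OF derivation_pairing_linear[OF D] zero] by blast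
  moreover have "closed {x. jordan_balanced ?\<phi> x}"
  proof -
    have cont_D: "continuous_on UNIV (\<lambda>x. D (f x))" if "continuous_on UNIV f" for f :: "'a \<Rightarrow> 'a"
      using continuous_on_compose2[OF cont that] by simp
    note cont_actions = bounded_bilinear.continuous_on[OF lact_bounded]
      bounded_bilinear.continuous_on[OF ract_bounded]
    show ?thesis
      unfolding jordan_balanced_def
      by (intro closed_Collect_conj closed_Collect_all closed_Collect_eq continuous_on_add
          cont_actions cont_D continuous_on_mult continuous_on_id continuous_on_const)
  qed
  ultimately have closure: "closure (idempotent_span scaleA) \<subseteq> {x. jordan_balanced ?\<phi> x}"
    by (rule closure_minimal)
  have balanced: "jordan_balanced ?\<phi> x" if "x \<in> J" for x
    using closure J(2) that by blast
  show ?thesis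
    by (rule generalized_jordan_derivation_if_jordan_balanced[OF D J(1,3) balanced])
qed

theorem theorem4p4:
  fixes scaleA :: "complex \<Rightarrow> 'a::{ring, monoid_mult} \<Rightarrow> 'a"
    and scaleM :: "complex \<Rightarrow> 'm::ab_group_add \<Rightarrow> 'm"
    and lact :: "'a \<Rightarrow> 'm \<Rightarrow> 'm"
    and ract :: "'m \<Rightarrow> 'a \<Rightarrow> 'm"
    and D :: "'a \<Rightarrow> 'm"
    and scaleB :: "complex \<Rightarrow> 'b::{real_normed_algebra, monoid_mult, banach} \<Rightarrow> 'b"
    and scaleN :: "complex \<Rightarrow> 'n::banach \<Rightarrow> 'n"
    and lactN :: "'b \<Rightarrow> 'n \<Rightarrow> 'n"
    and ractN :: "'n \<Rightarrow> 'b \<Rightarrow> 'n"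
    and E :: "'b \<Rightarrow> 'n"
  shows
    "(unital_bimodule scaleA scaleM lact ract \<and>
      property_M scaleA lact ract \<and>
      Vector_Spaces.linear scaleA scaleM D \<and>
      (\<forall>a b. a * b = 0 \<and> b * a = 0 \<longrightarrow> lact a (D b) + ract (D a) b = 0)
      \<longrightarrow>
      generalized_jordan_derivation scaleA scaleM lact ract D \<and>
      (\<forall>a. lact a (D 1) = ract (D 1) a))
     \<and>
     (unital_banach_bimodule scaleB scaleN lactN ractN \<and>
      property_M' scaleB lactN ractN \<and>
      Vector_Spaces.linear scaleB scaleN E \<and>
      continuous_on UNIV E \<and>
      (\<forall>a b. a * b = 0 \<and> b * a = 0 \<longrightarrow> lactN a (E b) + ractN (E a) b = 0)
      \<longrightarrow>
      generalized_jordan_derivation scaleB scaleN lactN ractN E \<and>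
      (\<forall>a. lactN a (E 1) = ractN (E 1) a))"
proof (rule conjI)
  show "unital_bimodule scaleA scaleM lact ract \<and>
      property_M scaleA lact ract \<and>
      Vector_Spaces.linear scaleA scaleM D \<and>
      (\<forall>a b. a * b = 0 \<and> b * a = 0 \<longrightarrow> lact a (D b) + ract (D a) b = 0)
      \<longrightarrow>
      generalized_jordan_derivation scaleA scaleM lact ract D \<and>
      (\<forall>a. lact a (D 1) = ract (D 1) a)"
    using unital_bimodule.zero_product_condition_property_M[of scaleA scaleM lact ract D] by simp
  show "unital_banach_bimodule scaleB scaleN lactN ractN \<and>
      property_M' scaleB lactN ractN \<and>
      Vector_Spaces.linear scaleB scaleN E \<and>
      continuous_on UNIV E \<and>
      (\<forall>a b. a * b = 0 \<and> b * a = 0 \<longrightarrow> lactN a (E b) + ractN (E a) b = 0)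
      \<longrightarrow>
      generalized_jordan_derivation scaleB scaleN lactN ractN E \<and>
      (\<forall>a. lactN a (E 1) = ractN (E 1) a)"
    using unital_banach_bimodule.zero_product_condition_property_M'[of scaleB scaleN lactN ractN E]
    by simp
qed

end
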